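(* Let $X$ and $Y$ be Banach spaces, let $\Gamma$ be an arbitrary set, let $E$ be an invariant sequence space over $X$, and for every $l\in\Gamma$ let $E_l$ be a strongly invariant sequence space over $Y$. If $f\colon X\to Y$ is compatible with $E_l$ for all $l\in\Gamma$, then the set $$G(E,f,(E_l)_{l\in\Gamma})=\left\{(x_j)_{j=1}^\infty\in E:\ (f(x_j))_{j=1}^\infty\notin\bigcup_{l\in\Gamma}E_l\right\}$$ is either empty or spaceable in $E$.
   Context: All Banach spaces are nonzero and are over the same scalar field $\mathbb{K}=\mathbb{R}$ or $\mathbb{C}$. For a Banach space $X\neq\{0\}$ and $x\in X^{\mathbb{N}}$, define $x^0$ as follows: if $x$ has only finitely many non-zero coordinates, then $x^0=0$; otherwise $x^0=(x_j)_{j=1}^\infty$, where $x_j$ is the $j$-th non-zero coordinate of $x$. An invariant sequence space over $X$ is an infinite-dimensional Banach or quasi-Banach space $E$ of $X$-valued sequences (with coordinatewise vector operations) such that: (b1) for $x\in X^{\mathbb{N}}$ with $x^0\ne0$, $x\in E$ if and only if $x^0\in E$, and in that case $\|x\|\le K\|x^0\|$ for some constant $K$ depending only on $E$; (b2) $\|x_j\|\le\|x\|$ for every $x=(x_j)_{j=1}^\infty\in E$ and every $j\in\mathbb{N}$. An invariant sequence space $E$ over $X$ is called strongly invariant if (a) $c_{00}(X)\subset E$, where $c_{00}(X)$ is the space of $X$-valued sequences with only finitely many non-zero coordinates; and (b) $(x_j)_{j=1}^\infty\in E$ if and only if all subsequences of $(x_j)_{j=1}^\infty$ also belong to $E$.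 If $F$ is an invariant sequence space over $Y$, a map $f\colon X\to Y$ with $f(0)=0$ (not assumed linear or continuous) is compatible with $F$ if for any sequence $(x_j)_{j=1}^\infty$ of elements of $X$ and any scalar $a\ne0$, $(f(x_j))_{j=1}^\infty\notin F$ implies $(f(ax_j))_{j=1}^\infty\notin F$. A subset $A$ of $E$ is spaceable in $E$ if $A\cup\{0\}$ contains a closed infinite-dimensional linear subspace of $E$. *)

theory Defs
  imports "HOL-Analysis.Analysis" "HOL-Library.Function_Algebras"
begin

section \<open>Scalar fields and Banach spaces\<close>

text \<open>
  The scalar field is the real or the complex numbers: a real normed field that either consists
  of the (embedded) reals only, or is the reals with a square root of \<open>-1\<close> adjoined, with the
  usual modulus.
\<close>

class rc_field = real_normed_field +
  assumes real_or_complex: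
    "(\<forall>z. \<exists>a. z = a *\<^sub>R 1) \<or>
     (\<exists>i. i * i = - 1 \<and>
        (\<forall>z. \<exists>a b. z = a *\<^sub>R 1 + b *\<^sub>R i \<and> norm z = sqrt (a\<^sup>2 + b\<^sup>2)))"

instance real :: rc_field
  by standard auto

instance complex :: rc_field
proof
  have "\<forall>z. \<exists>a b. z = a *\<^sub>R 1 + b *\<^sub>R \<i> \<and> norm z = sqrt (a\<^sup>2 + b\<^sup>2)"
  proof
    fix z :: complex
    have "z = Re z *\<^sub>R 1 + Im z *\<^sub>R \<i>"
      by (simp add: complex_eq_iff)
    then show "\<exists>a b. z = a *\<^sub>R 1 + b *\<^sub>R \<i> \<and> norm z = sqrt (a\<^sup>2 + b\<^sup>2)"
      using cmod_def by blast
  qed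
  then show "(\<forall>z::complex. \<exists>a. z = a *\<^sub>R 1) \<or>
     (\<exists>i::complex. i * i = - 1 \<and>
        (\<forall>z. \<exists>a b. z = a *\<^sub>R 1 + b *\<^sub>R i \<and> norm z = sqrt (a\<^sup>2 + b\<^sup>2)))"
    using i_squared by blast
qed

text \<open>
  The class \<open>banach\<close> only provides real scalars; the action of the scalar field
  is the parameter \<open>scale\<close>, which extends the real one.
\<close>

locale rc_banach_space = vector_space scale
  for scale :: "'k::rc_field \<Rightarrow> 'x::banach \<Rightarrow> 'x" +
  assumes scale_of_real: "scale (of_real r) x = r *\<^sub>R x"
    and norm_scale: "norm (scale c x) = norm c * norm x"
    and nonzero: "\<exists>x::'x. x \<noteq> 0"

section \<open>Quasi-Banach spaces and spaceability\<close>

text \<open>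
  \<open>E\<close> is a linear subspace of the ambient vector space, complete under the quasi-norm \<open>N\<close>,
  whose values outside \<open>E\<close> are irrelevant. Banach spaces are the case \<open>C = 1\<close> of
  \<open>quasi_triangle\<close>.
\<close>

locale quasi_banach_space = vector_space scale
  for scale :: "'k::rc_field \<Rightarrow> 'v::ab_group_add \<Rightarrow> 'v" +
  fixes E :: "'v set" and N :: "'v \<Rightarrow> real"
  assumes subspace: "subspace E"
    and nonneg: "x \<in> E \<Longrightarrow> 0 \<le> N x"
    and eq_0_iff: "x \<in> E \<Longrightarrow> N x = 0 \<longleftrightarrow> x = 0"
    and homogeneous: "x \<in> E \<Longrightarrow> N (scale c x) = norm c * N x"
    and quasi_triangle: "\<exists>C\<ge>1. \<forall>x\<in>E. \<forall>y\<in>E. N (x + y) \<le> C * (N x + N y)"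
    and complete:
      "\<lbrakk>\<And>n. u n \<in> E; \<And>e. e > 0 \<Longrightarrow> \<exists>M. \<forall>m\<ge>M. \<forall>n\<ge>M. N (u m - u n) < e\<rbrakk>
        \<Longrightarrow> \<exists>x\<in>E. (\<lambda>n. N (u n - x)) \<longlonglongrightarrow> 0"

text \<open>
  Balls of a quasi-norm need not be open, so they are not used as a base: a set is open
  if it contains a ball around each of its points.
\<close>

definition quasinorm_topology :: "'v::ab_group_add set \<Rightarrow> ('v \<Rightarrow> real) \<Rightarrow> 'v topology" where
  "quasinorm_topology E N =
     topology (\<lambda>U. U \<subseteq> E \<and> (\<forall>x\<in>U. \<exists>e>0. \<forall>y\<in>E. N (y - x) < e \<longrightarrow> y \<in> U))"

lemma openin_quasinorm_topology:
  "openin (quasinorm_topology E N) U \<longleftrightarrow>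
     U \<subseteq> E \<and> (\<forall>x\<in>U. \<exists>e>0. \<forall>y\<in>E. N (y - x) < e \<longrightarrow> y \<in> U)"
proof -
  let ?P = "\<lambda>U. U \<subseteq> E \<and> (\<forall>x\<in>U. \<exists>e>0. \<forall>y\<in>E. N (y - x) < e \<longrightarrow> y \<in> U)"
  have "?P (S \<inter> T)" if S: "?P S" and T: "?P T" for S T
  proof (intro conjI ballI)
    show "S \<inter> T \<subseteq> E" using S by blast
    fix x assume x: "x \<in> S \<inter> T"
    obtain d where d: "d > 0" "\<forall>y\<in>E. N (y - x) < d \<longrightarrow> y \<in> S" using S x by blast
    obtain e where e: "e > 0" "\<forall>y\<in>E. N (y - x) < e \<longrightarrow> y \<in> T" using T x by blast
    show "\<exists>e>0. \<forall>y\<in>E. N (y - x) < e \<longrightarrow> y \<in> S \<inter> T"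
      using d e by (intro exI[of _ "min d e"]) auto
  qed
  moreover have "?P (\<Union>\<K>)" if "\<forall>K\<in>\<K>. ?P K" for \<K>
    using that by (meson Union_iff Union_least)
  ultimately have "istopology ?P"
    unfolding istopology_def by blast
  then show ?thesis
    by (simp add: quasinorm_topology_def topology_inverse')
qed

definition infinite_dimensional :: "('k::field \<Rightarrow> 'v::ab_group_add \<Rightarrow> 'v) \<Rightarrow> 'v set \<Rightarrow> bool" where
  "infinite_dimensional sc V \<longleftrightarrow> (\<nexists>B. finite B \<and> V \<subseteq> module.span sc B)"

definition spaceable ::
    "('k::field \<Rightarrow> 'v::ab_group_add \<Rightarrow> 'v) \<Rightarrow> 'v set \<Rightarrow> ('v \<Rightarrow> real) \<Rightarrow> 'v set \<Rightarrow> bool" where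
  "spaceable sc E N A \<longleftrightarrow> A \<subseteq> E \<and>
     (\<exists>V. V \<subseteq> A \<union> {0} \<and> module.subspace sc V \<and> infinite_dimensional sc V \<and>
          closedin (quasinorm_topology E N) V)"

section \<open>Invariant sequence spaces\<close>

text \<open>Sequences are indexed from 0; their additive structure is the pointwise one.\<close>

definition seq_scale :: "('k \<Rightarrow> 'x \<Rightarrow> 'x) \<Rightarrow> 'k \<Rightarrow> (nat \<Rightarrow> 'x) \<Rightarrow> nat \<Rightarrow> 'x" where
  "seq_scale sc a x = (\<lambda>j. sc a (x j))"

lemma vector_space_seq_scale:
  assumes "vector_space sc"
  shows "vector_space (seq_scale sc)"
proof -
  interpret vector_space sc by fact
  show ?thesis
    by standard (auto simp: seq_scale_def fun_eq_iff scale_right_distrib scale_left_distrib)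
qed

definition condense :: "(nat \<Rightarrow> 'x::zero) \<Rightarrow> nat \<Rightarrow> 'x"  (\<open>(_\<^sup>0)\<close> [1000] 999) where
  "x\<^sup>0 = (if finite {j. x j \<noteq> 0} then (\<lambda>_. 0) else (\<lambda>n. x (enumerate {j. x j \<noteq> 0} n)))"

definition c00 :: "(nat \<Rightarrow> 'x::zero) set" where
  "c00 = {x. finite {j. x j \<noteq> 0}}"

locale invariant_sequence_space =
  rc_banach_space scale + seq: quasi_banach_space "seq_scale scale" E N
  for scale :: "'k::rc_field \<Rightarrow> 'x::banach \<Rightarrow> 'x"
    and E :: "(nat \<Rightarrow> 'x) set" and N :: "(nat \<Rightarrow> 'x) \<Rightarrow> real" +
  assumes infinite_dim: "infinite_dimensional (seq_scale scale) E"
    and mem_iff_condense: "x\<^sup>0 \<noteq> 0 \<Longrightarrow> x \<in> E \<longleftrightarrow> x\<^sup>0 \<in> E"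
    and norm_le_condense: "\<exists>K. \<forall>x\<in>E. x\<^sup>0 \<noteq> 0 \<longrightarrow> N x \<le> K * N (x\<^sup>0)"
    and norm_coord_le: "x \<in> E \<Longrightarrow> norm (x j) \<le> N x"

locale strongly_invariant_sequence_space = invariant_sequence_space +
  assumes c00_subset: "c00 \<subseteq> E"
    and mem_iff_subseqs: "x \<in> E \<longleftrightarrow> (\<forall>r::nat \<Rightarrow> nat. strict_mono r \<longrightarrow> x \<circ> r \<in> E)"

definition compatible ::
    "('k::field \<Rightarrow> 'x::ab_group_add \<Rightarrow> 'x) \<Rightarrow> ('x \<Rightarrow> 'y::zero) \<Rightarrow> (nat \<Rightarrow> 'y) set \<Rightarrow> bool" where
  "compatible sc f F \<longleftrightarrow> f 0 = 0 \<and>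
     (\<forall>x. \<forall>a. a \<noteq> 0 \<longrightarrow> (\<lambda>j. f (x j)) \<notin> F \<longrightarrow> (\<lambda>j. f (sc a (x j))) \<notin> F)"

definition G_set ::
    "(nat \<Rightarrow> 'x) set \<Rightarrow> ('x \<Rightarrow> 'y) \<Rightarrow> 'l set \<Rightarrow> ('l \<Rightarrow> (nat \<Rightarrow> 'y) set) \<Rightarrow> (nat \<Rightarrow> 'x) set" where
  "G_set E f \<Gamma> F = {x \<in> E. (\<lambda>j. f (x j)) \<notin> (\<Union>l\<in>\<Gamma>. F l)}"

end

theory Submission
  imports Defs
begin

text \<open>
  Let \<open>x\<close> be a member of the set \<open>G\<close> in question and cut the index set into infinitely many infinite
  blocks. Consider the space \<open>V\<close> of all \<open>z \<in> E\<close> that restrict, on each block \<open>i\<close>, to a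
  scalar multiple \<open>a\<^sub>i x\<close> of \<open>x\<close>, re-indexed along the block.

  Every nonzero \<open>z \<in> V\<close> lies in \<open>G\<close>: some \<open>a\<^sub>i\<close> is nonzero, so compatibility excludes
  \<open>f \<circ> (a\<^sub>i x)\<close> from every \<open>F l\<close>; this sequence is a subsequence of \<open>f \<circ> z\<close>, so
  \<open>f \<circ> z\<close> is excluded as well (\<open>blockwise_multiple_not_mem\<close>).

  The subspace \<open>V\<close> is closed because the norm of \<open>E\<close> dominates the coordinates: a limit of elements of
  \<open>V\<close> is a coordinatewise limit, and coordinatewise limits of multiples of \<open>x\<close> are multiples of \<open>x\<close>
  since the scalar field is locally compact (\<open>closedin_blockwise_multiples\<close>). Defining \<open>V\<close> by
  coordinate conditions, rather than as a closed span, requires no estimate of infinite sums in a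
  quasi-norm.

  The subspace \<open>V\<close> is infinite-dimensional because it contains, for each block, the copy of \<open>x\<close>
  supported there. The copy belongs to \<open>E\<close> because it has the same condensation as \<open>x\<close>, provided
  that \<open>x\<close> has infinitely many nonzero terms
  (\<open>infinite_dimensional_blockwise_multiples\<close>). That proviso holds as soon as there is one
  \<open>F l\<close>: this space contains the finitely supported sequences, but not \<open>f \<circ> x\<close>. If the family of spaces is
  empty, \<open>x\<close> may be finitely supported, but then \<open>G = E\<close> and \<open>E\<close> itself is the subspace.
\<close>

section \<open>Closedness of one-dimensional spaces\<close>

text \<open>
  The Bolzano--Weierstrass theorem for the scalar field. It is pulled back from the complex numbers through
  the coordinates that the class axiom provides, with \<open>i = 0\<close> standing in for the imaginary unit when the
  field is real.
\<close>

lemma rc_field_bounded_convergent_subsequence: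
  fixes a :: "nat \<Rightarrow> 'k::rc_field"
  assumes bounded: "\<And>n. norm (a n) \<le> B"
  obtains l r where "strict_mono (r :: nat \<Rightarrow> nat)" "(a \<circ> r) \<longlonglongrightarrow> l"
proof -
  have "\<exists>i::'k. \<forall>z. \<exists>s t. z = s *\<^sub>R 1 + t *\<^sub>R i \<and> norm z = sqrt (s\<^sup>2 + t\<^sup>2)"
    using real_or_complex
  proof (elim disjE)
    assume real: "\<forall>z::'k. \<exists>s. z = s *\<^sub>R 1"
    have "\<exists>s t. z = s *\<^sub>R 1 + t *\<^sub>R 0 \<and> norm z = sqrt (s\<^sup>2 + t\<^sup>2)" for z :: 'k
    proof -
      obtain s where "z = s *\<^sub>R 1"
        using real by blast
      then show ?thesis
        by (intro exI[of _ s] exI[of _ 0]) simp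
    qed
    then show ?thesis by blast
  qed blast
  then obtain i :: 'k where
    "\<forall>n. \<exists>s t. a n = s *\<^sub>R 1 + t *\<^sub>R i \<and> norm (a n) = sqrt (s\<^sup>2 + t\<^sup>2)"
    by blast
  then obtain s t where st:
    "\<And>n. a n = s n *\<^sub>R 1 + t n *\<^sub>R i" "\<And>n. norm (a n) = sqrt ((s n)\<^sup>2 + (t n)\<^sup>2)"
    by metis
  define c where "c n = Complex (s n) (t n)" for n
  have "norm (c n) \<le> B" for n
    using bounded[of n] by (simp add: c_def st(2) cmod_def)
  then have "bounded (range c)"
    by (auto simp: bounded_iff)
  then obtain l r where r: "strict_mono (r :: nat \<Rightarrow> nat)" and l: "(c \<circ> r) \<longlonglongrightarrow> l"
    using bounded_imp_convergent_subsequence by blast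
  have "(\<lambda>n. Re ((c \<circ> r) n) *\<^sub>R 1 + Im ((c \<circ> r) n) *\<^sub>R i) \<longlonglongrightarrow> Re l *\<^sub>R 1 + Im l *\<^sub>R i"
    by (intro tendsto_intros l)
  moreover have "(\<lambda>n. Re ((c \<circ> r) n) *\<^sub>R 1 + Im ((c \<circ> r) n) *\<^sub>R i) = a \<circ> r"
    by (simp add: fun_eq_iff c_def st(1))
  ultimately show ?thesis
    using that r by metis
qed

text \<open>
  If \<open>v k \<noteq> 0\<close>, convergence of the coordinate \<open>k\<close> bounds the scalars, and any cluster point of them
  represents the limit in all coordinates at once.
\<close>

lemma (in rc_banach_space) scalar_multiples_coordinatewise_closed:
  fixes v z :: "nat \<Rightarrow> 'x"
  assumes lim: "\<And>k. (\<lambda>n. scale (a n) (v k)) \<longlonglongrightarrow> z k"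
  shows "\<exists>b. \<forall>k. z k = scale b (v k)"
proof (cases "v = (\<lambda>_. 0)")
  case True
  then have "z k = 0" for k
    using lim[of k] by (simp add: LIMSEQ_const_iff)
  then show ?thesis
    using True by (intro exI[of _ 0]) simp
next
  case False
  then obtain k where k: "v k \<noteq> 0"
    by auto
  obtain B where "\<And>n. norm (scale (a n) (v k)) \<le> B"
    using convergent_imp_Bseq[OF convergentI[OF lim[of k]]] unfolding Bseq_def by blast
  then have "norm (a n) \<le> B / norm (v k)" for n
    using k by (simp add: norm_scale pos_le_divide_eq)
  then obtain b r where r: "strict_mono (r :: nat \<Rightarrow> nat)" and b: "(a \<circ> r) \<longlonglongrightarrow> b"
    by (rule rc_field_bounded_convergent_subsequence)
  have "z j = scale b (v j)" for j
  proof (rule LIMSEQ_unique)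
    show "(\<lambda>n. scale (a (r n)) (v j)) \<longlonglongrightarrow> z j"
      using LIMSEQ_subseq_LIMSEQ[OF lim r] by (simp add: o_def)
    have "(\<lambda>n. norm ((a \<circ> r) n - b) * norm (v j)) \<longlonglongrightarrow> 0"
      using tendsto_mult_right[OF tendsto_norm_zero[OF LIM_zero[OF b]], of "norm (v j)"] by simp
    then have "(\<lambda>n. norm (scale (a (r n)) (v j) - scale b (v j))) \<longlonglongrightarrow> 0"
      by (simp add: norm_scale flip: scale_left_diff_distrib)
    then show "(\<lambda>n. scale (a (r n)) (v j)) \<longlonglongrightarrow> scale b (v j)"
      by (rule LIM_zero_cancel[OF tendsto_norm_zero_cancel])
  qed
  then show ?thesis by blast
qed

section \<open>Spreading a sequence along a strictly increasing index map\<close>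

lemma strict_mono_eq_enumerate:
  fixes e :: "nat \<Rightarrow> nat"
  assumes e: "strict_mono e"
  shows "enumerate (range e) = e"
proof -
  have inf: "infinite (range e)"
    using e by (simp add: range_inj_infinite strict_mono_imp_inj_on)
  have ran: "range (enumerate (range e)) = range e"
    using inf by (rule range_enumerate)
  have "enumerate (range e) n = e n" for n
  proof (induction n rule: less_induct)
    case (less n)
    let ?d = "enumerate (range e)"
    have d: "strict_mono ?d"
      using inf by (rule strict_mono_enumerate)
    obtain m where m: "?d n = e m"
      using ran by (metis rangeE rangeI)
    obtain p where p: "e n = ?d p"
      using ran by (metis rangeE rangeI)
    \<comment> \<open>The two maps agree below \<open>n\<close>, so a preimage below \<open>n\<close> would contradict injectivity.\<close>
    have "n \<le> m"
      using less m d by (metis not_le strict_mono_less less_irrefl)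
    moreover have "n \<le> p"
      using less p e by (metis not_le strict_mono_less less_irrefl)
    ultimately show ?case
      using m p d e by (metis order_antisym strict_mono_less_eq)
  qed
  then show ?thesis by blast
qed

text \<open>
  Dropping only zeros does not change the condensation: \<open>e\<close> carries the increasing enumeration of
  the support of \<open>x \<circ> e\<close> to an increasing enumeration of the support of \<open>x\<close>, and there is only one.
\<close>

lemma condense_comp:
  fixes e :: "nat \<Rightarrow> nat" and x :: "nat \<Rightarrow> 'x::zero"
  assumes e: "strict_mono e" and supp: "{j. x j \<noteq> 0} \<subseteq> range e"
  shows "(x \<circ> e)\<^sup>0 = x\<^sup>0"
proof -
  let ?S = "{k. (x \<circ> e) k \<noteq> 0}"
  have S: "{j. x j \<noteq> 0} = e ` ?S"
    using supp by auto
  have inj: "inj e"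
    using e by (rule strict_mono_imp_inj_on)
  have fin: "finite {j. x j \<noteq> 0} \<longleftrightarrow> finite ?S"
    unfolding S using inj by (metis finite_imageD finite_imageI inj_on_subset subset_UNIV)
  show ?thesis
  proof (cases "finite ?S")
    case True
    with fin show ?thesis by (simp add: condense_def)
  next
    case False
    have mono: "strict_mono (e \<circ> enumerate ?S)"
      using e strict_mono_enumerate[OF False] by (rule strict_mono_o)
    have "range (e \<circ> enumerate ?S) = {j. x j \<noteq> 0}"
      unfolding S image_comp[symmetric] range_enumerate[OF False] ..
    then have "enumerate {j. x j \<noteq> 0} = e \<circ> enumerate ?S"
      using strict_mono_eq_enumerate[OF mono] by simp
    then show ?thesis
      using False fin by (simp add: condense_def fun_eq_iff)
  qed
qed

lemma condense_nonzero:
  assumes "infinite {j. x j \<noteq> 0}"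
  shows "x\<^sup>0 \<noteq> 0"
proof -
  have "x (enumerate {j. x j \<noteq> 0} 0) \<noteq> 0"
    using enumerate_in_set[OF assms] by blast
  then show ?thesis
    using assms by (auto simp: condense_def fun_eq_iff)
qed

lemma (in invariant_sequence_space) mem_of_comp_mem:
  assumes e: "strict_mono e" and supp: "{j. y j \<noteq> 0} \<subseteq> range e"
    and inf: "infinite {k. y (e k) \<noteq> 0}" and mem: "y \<circ> e \<in> E"
  shows "y \<in> E"
proof -
  have eq: "(y \<circ> e)\<^sup>0 = y\<^sup>0"
    using e supp by (rule condense_comp)
  have "(y \<circ> e)\<^sup>0 \<noteq> 0"
    using inf condense_nonzero[of "y \<circ> e"] by simp
  with eq mem show ?thesis
    using mem_iff_condense[of y] mem_iff_condense[of "y \<circ> e"] by simp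
qed

section \<open>Coordinatewise closed sets\<close>

text \<open>Convergence in the quasi-norm forces convergence of each coordinate, since \<open>N\<close> dominates the
  coordinate norms.\<close>

lemma (in invariant_sequence_space) closedin_if_coordinatewise_closed:
  assumes sub: "V \<subseteq> E"
    and lim: "\<And>u z. \<lbrakk>\<And>n. u n \<in> V; z \<in> E; \<And>j. (\<lambda>n. u n j) \<longlonglongrightarrow> z j\<rbrakk> \<Longrightarrow> z \<in> V"
  shows "closedin (quasinorm_topology E N) V"
proof -
  have E: "topspace (quasinorm_topology E N) = E"
  proof
    show "topspace (quasinorm_topology E N) \<subseteq> E"
      using openin_topspace[of "quasinorm_topology E N"] unfolding openin_quasinorm_topology by blast
    show "E \<subseteq> topspace (quasinorm_topology E N)"
      by (intro openin_subset) (auto simp: openin_quasinorm_topology intro: exI[of _ 1])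
  qed
  have "\<exists>d>0. \<forall>y\<in>E. N (y - z) < d \<longrightarrow> y \<in> E - V" if z: "z \<in> E - V" for z
  proof (rule ccontr)
    assume "\<not> ?thesis"
    then have "\<forall>n. \<exists>y\<in>V. N (y - z) < inverse (real (Suc n))"
      by (metis DiffI inverse_positive_iff_positive of_nat_0_less_iff zero_less_Suc)
    then obtain u where u: "\<And>n. u n \<in> V" "\<And>n. N (u n - z) < inverse (real (Suc n))"
      by metis
    have "(\<lambda>n. u n j) \<longlonglongrightarrow> z j" for j
    proof (rule LIM_zero_cancel, rule Lim_null_comparison)
      have "u n - z \<in> E" for n
        using u(1) sub z seq.subspace by (blast intro: seq.subspace_diff)
      then have "norm (u n j - z j) \<le> inverse (real (Suc n))" for n
        using norm_coord_le[of "u n - z" j] u(2)[of n] by force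
      then show "\<forall>\<^sub>F n in sequentially. norm (u n j - z j) \<le> inverse (real (Suc n))"
        by simp
      show "(\<lambda>n. inverse (real (Suc n))) \<longlonglongrightarrow> 0"
        by (rule LIMSEQ_inverse_real_of_nat)
    qed
    then have "z \<in> V"
      using lim[of u z] u(1) z by blast
    with z show False by blast
  qed
  then show ?thesis
    using sub E by (simp add: closedin_def openin_quasinorm_topology)
qed

section \<open>The subspace of blockwise multiples\<close>

text \<open>The Cantor pairing function makes every block index map increasing and the blocks a partition
  of the index set.\<close>

definition block :: "nat \<Rightarrow> nat \<Rightarrow> nat" where
  "block i k = prod_encode (i, k)"

lemma strict_mono_block: "strict_mono (block i)"
  by (rule strict_monoI_Suc) (simp add: block_def prod_encode_def)

lemma block_cases: obtains i k where "j = block i k"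
  unfolding block_def by (metis prod.exhaust prod_decode_inverse)

definition spread :: "(nat \<Rightarrow> 'x::zero) \<Rightarrow> nat \<Rightarrow> nat \<Rightarrow> 'x" where
  "spread x i j = (case prod_decode j of (i', k) \<Rightarrow> if i' = i then x k else 0)"

lemma spread_block: "spread x i (block i' k) = (if i' = i then x k else 0)"
  by (simp add: spread_def block_def)

definition blockwise_multiples ::
    "('k \<Rightarrow> 'x \<Rightarrow> 'x) \<Rightarrow> (nat \<Rightarrow> 'x) set \<Rightarrow> (nat \<Rightarrow> 'x) \<Rightarrow> (nat \<Rightarrow> 'x) set" where
  "blockwise_multiples sc E x = {z \<in> E. \<forall>i. \<exists>a. \<forall>k. z (block i k) = sc a (x k)}"

context invariant_sequence_space
begin

lemma subspace_blockwise_multiples: "seq.subspace (blockwise_multiples scale E x)"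
proof (rule seq.subspaceI)
  show "0 \<in> blockwise_multiples scale E x"
    using seq.subspace_0[OF seq.subspace]
    by (auto simp: blockwise_multiples_def intro!: exI[of _ 0])
next
  fix y z assume y: "y \<in> blockwise_multiples scale E x" and z: "z \<in> blockwise_multiples scale E x"
  have "\<exists>c. \<forall>k. (y + z) (block i k) = scale c (x k)" for i
  proof -
    obtain a where "\<forall>k. y (block i k) = scale a (x k)"
      using y by (auto simp: blockwise_multiples_def)
    moreover obtain b where "\<forall>k. z (block i k) = scale b (x k)"
      using z by (auto simp: blockwise_multiples_def)
    ultimately show ?thesis
      by (intro exI[of _ "a + b"]) (simp add: scale_left_distrib)
  qed
  then show "y + z \<in> blockwise_multiples scale E x"
    using y z seq.subspace_add[OF seq.subspace] by (simp add: blockwise_multiples_def)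
next
  fix c z assume z: "z \<in> blockwise_multiples scale E x"
  have "\<exists>b. \<forall>k. seq_scale scale c z (block i k) = scale b (x k)" for i
  proof -
    obtain a where "\<forall>k. z (block i k) = scale a (x k)"
      using z by (auto simp: blockwise_multiples_def)
    then show ?thesis
      by (intro exI[of _ "c * a"]) (simp add: seq_scale_def)
  qed
  then show "seq_scale scale c z \<in> blockwise_multiples scale E x"
    using z seq.subspace_scale[OF seq.subspace] by (simp add: blockwise_multiples_def)
qed

lemma closedin_blockwise_multiples:
  "closedin (quasinorm_topology E N) (blockwise_multiples scale E x)"
proof (rule closedin_if_coordinatewise_closed)
  show "blockwise_multiples scale E x \<subseteq> E"
    by (auto simp: blockwise_multiples_def)
next
  fix u z
  assume u: "\<And>n. u n \<in> blockwise_multiples scale E x" and z: "z \<in> E"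
    and lim: "\<And>j. (\<lambda>n. u n j) \<longlonglongrightarrow> z j"
  have "\<exists>b. \<forall>k. z (block i k) = scale b (x k)" for i
  proof -
    have "\<forall>n. \<exists>a. \<forall>k. u n (block i k) = scale a (x k)"
      using u by (auto simp: blockwise_multiples_def)
    then obtain a where a: "\<And>n k. u n (block i k) = scale (a n) (x k)"
      by metis
    show ?thesis
      by (rule scalar_multiples_coordinatewise_closed[of a]) (use lim in \<open>simp flip: a\<close>)
  qed
  with z show "z \<in> blockwise_multiples scale E x"
    by (simp add: blockwise_multiples_def)
qed

text \<open>The copy of \<open>x\<close> on a block has the same condensation as \<open>x\<close>. Infinite support makes
  this condensation nonzero, so that it decides membership in \<open>E\<close>.\<close>

lemma spread_mem_blockwise_multiples:
  assumes x: "x \<in> E" and inf: "infinite {k. x k \<noteq> 0}"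
  shows "spread x i \<in> blockwise_multiples scale E x"
proof -
  have "spread x i \<in> E"
  proof (rule mem_of_comp_mem[OF strict_mono_block[of i]])
    show "{j. spread x i j \<noteq> 0} \<subseteq> range (block i)"
    proof
      fix j assume j: "j \<in> {j. spread x i j \<noteq> 0}"
      obtain i' k where "j = block i' k"
        by (rule block_cases)
      with j show "j \<in> range (block i)"
        by (auto simp: spread_block split: if_splits)
    qed
  qed (use x inf in \<open>simp_all add: spread_block o_def\<close>)
  moreover have "\<exists>a. \<forall>k. spread x i (block i' k) = scale a (x k)" for i'
    by (intro exI[of _ "if i' = i then 1 else 0"]) (simp add: spread_block)
  ultimately show ?thesis
    by (simp add: blockwise_multiples_def)
qed

text \<open>The copies of \<open>x\<close> on the different blocks are linearly independent, as all but the \<open>i\<close>-th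
  vanish on the block \<open>i\<close>.\<close>

lemma infinite_dimensional_blockwise_multiples:
  assumes x: "x \<in> E" and inf: "infinite {k. x k \<noteq> 0}"
  shows "infinite_dimensional (seq_scale scale) (blockwise_multiples scale E x)"
  unfolding infinite_dimensional_def
proof
  assume "\<exists>B. finite B \<and> blockwise_multiples scale E x \<subseteq> seq.span B"
  then obtain B where B: "finite B" "blockwise_multiples scale E x \<subseteq> seq.span B"
    by blast
  obtain k where k: "x k \<noteq> 0"
    using inf by (metis (mono_tags, lifting) Collect_empty_eq finite.emptyI)
  have inj: "inj (spread x)"
  proof (rule injI, rule ccontr)
    fix i i' assume eq: "spread x i = spread x i'" and "i \<noteq> i'"
    then show False
      using k fun_cong[OF eq, of "block i k", unfolded spread_block] by simp
  qed
  have "\<not> seq.dependent (range (spread x))"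
    unfolding seq.dependent_def
  proof clarify
    fix i assume dep: "spread x i \<in> seq.span (range (spread x) - {spread x i})"
    let ?Z = "{z. z (block i k) = 0}"
    have "seq.subspace ?Z"
      by (rule seq.subspaceI) (simp_all add: seq_scale_def)
    moreover have "range (spread x) - {spread x i} \<subseteq> ?Z"
      by (auto simp: spread_block)
    ultimately have "seq.span (range (spread x) - {spread x i}) \<subseteq> ?Z"
      by (intro seq.span_minimal)
    with dep k show False
      by (auto simp: spread_block)
  qed
  moreover have "range (spread x) \<subseteq> seq.span B"
    using B(2) spread_mem_blockwise_multiples[OF x inf] by blast
  ultimately have "finite (range (spread x))"
    using seq.independent_span_bound[OF B(1)] by blast
  with inj show False
    by (simp add: range_inj_infinite)
qed

lemma closedin_carrier: "closedin (quasinorm_topology E N) E"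
  by (rule closedin_if_coordinatewise_closed) auto

end

section \<open>Images of blockwise multiples\<close>

text \<open>
  A nonzero \<open>z\<close> has a nonzero multiple of \<open>x\<close> on some block. Compatibility applies to this multiple, and
  membership of \<open>f \<circ> z\<close> would pass to the subsequence along the block.
\<close>

lemma (in strongly_invariant_sequence_space) blockwise_multiple_not_mem:
  assumes comp: "compatible sc f E" and x: "f \<circ> x \<notin> E"
    and z: "z \<in> blockwise_multiples sc D x" "z \<noteq> 0" and zero: "\<And>v. sc 0 v = 0"
  shows "f \<circ> z \<notin> E"
proof -
  obtain j where "z j \<noteq> 0"
    using z(2) by (auto simp: fun_eq_iff)
  moreover obtain i k where "j = block i k"
    by (rule block_cases)
  moreover obtain a where a: "\<And>k. z (block i k) = sc a (x k)"
    using z(1) by (auto simp: blockwise_multiples_def)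
  ultimately have "a \<noteq> 0"
    using zero by auto
  then have "(\<lambda>k. f (sc a (x k))) \<notin> E"
    using comp x by (simp add: compatible_def o_def)
  then have "(f \<circ> z) \<circ> block i \<notin> E"
    by (simp add: o_def a)
  then show ?thesis
    using mem_iff_subseqs strict_mono_block by blast
qed

lemma (in strongly_invariant_sequence_space) infinite_support_if_image_not_mem:
  assumes "f 0 = 0" and "f \<circ> x \<notin> E"
  shows "infinite {k. x k \<noteq> 0}"
proof
  assume "finite {k. x k \<noteq> 0}"
  moreover have "{k. (f \<circ> x) k \<noteq> 0} \<subseteq> {k. x k \<noteq> 0}"
    using assms(1) by auto
  ultimately have "f \<circ> x \<in> c00"
    unfolding c00_def using finite_subset by blast
  with assms(2) c00_subset show False by blast
qed

theorem theorem2p5: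
  fixes scaleX :: "'k::rc_field \<Rightarrow> 'x::banach \<Rightarrow> 'x"
    and scaleY :: "'k \<Rightarrow> 'y::banach \<Rightarrow> 'y"
    and \<Gamma> :: "'l set"
    and E :: "(nat \<Rightarrow> 'x) set" and N :: "(nat \<Rightarrow> 'x) \<Rightarrow> real"
    and F :: "'l \<Rightarrow> (nat \<Rightarrow> 'y) set" and NF :: "'l \<Rightarrow> (nat \<Rightarrow> 'y) \<Rightarrow> real"
    and f :: "'x \<Rightarrow> 'y"
  assumes "rc_banach_space scaleX"
    and "rc_banach_space scaleY"
    and "invariant_sequence_space scaleX E N"
    and "\<And>l. l \<in> \<Gamma> \<Longrightarrow> strongly_invariant_sequence_space scaleY (F l) (NF l)"
    and "\<And>l. l \<in> \<Gamma> \<Longrightarrow> compatible scaleX f (F l)"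
  shows "G_set E f \<Gamma> F = {} \<or> spaceable (seq_scale scaleX) E N (G_set E f \<Gamma> F)"
proof (cases "G_set E f \<Gamma> F = {}")
  case False
  interpret E: invariant_sequence_space scaleX E N by fact
  let ?G = "G_set E f \<Gamma> F"
  from False obtain x where x: "x \<in> E" "\<And>l. l \<in> \<Gamma> \<Longrightarrow> f \<circ> x \<notin> F l"
    by (auto simp: G_set_def o_def)
  have "\<exists>V \<subseteq> ?G \<union> {0}. E.seq.subspace V \<and> infinite_dimensional (seq_scale scaleX) V \<and>
          closedin (quasinorm_topology E N) V"
  proof (cases "\<Gamma> = {}")
    case True
    then have "E \<subseteq> ?G \<union> {0}"
      by (auto simp: G_set_def)
    then show ?thesis
      by (intro exI[of _ E] conjI E.seq.subspace E.infinite_dim E.closedin_carrier)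
  next
    case False
    then obtain l where l: "l \<in> \<Gamma>"
      by blast
    have "f 0 = 0"
      using assms(5)[OF l] by (simp add: compatible_def)
    then have inf: "infinite {k. x k \<noteq> 0}"
      by (rule strongly_invariant_sequence_space.infinite_support_if_image_not_mem
          [OF assms(4)[OF l] _ x(2)[OF l]])
    let ?V = "blockwise_multiples scaleX E x"
    have "z \<in> ?G" if z: "z \<in> ?V" "z \<noteq> 0" for z
    proof -
      have "f \<circ> z \<notin> F l" if "l \<in> \<Gamma>" for l
        by (rule strongly_invariant_sequence_space.blockwise_multiple_not_mem
            [OF assms(4,5) x(2) z E.scale_zero_left]) (fact that)+
      moreover have "z \<in> E"
        using z(1) by (simp add: blockwise_multiples_def)
      ultimately show ?thesis
        by (auto simp: G_set_def o_def)
    qed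
    then have "?V \<subseteq> ?G \<union> {0}"
      by blast
    then show ?thesis
      by (intro exI[of _ ?V] conjI E.subspace_blockwise_multiples E.closedin_blockwise_multiples
          E.infinite_dimensional_blockwise_multiples[OF x(1) inf])
  qed
  moreover have "?G \<subseteq> E"
    by (auto simp: G_set_def)
  ultimately show ?thesis
    by (simp add: spaceable_def)
qed simp

end
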